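(* Let $p$ be an odd prime, let $n\ge 1$ be an integer, and let $k \in \mathbb{Z}_{p^n}^{\times}$ with $\mathrm{ord}(k) = p^{n-1}(p-1)$. Denote $\mathrm{wt}(p,s;p-1)$ by $\mathrm{wt}(p)$, where $s$ is the image of $k$ under the natural surjection $\mathbb{Z}_{p^n} \rightarrow \mathbb{Z}_p$. Then $$\mathrm{wt}(p) \leq \mathrm{wt}(p^n, k; p^{n-1}(p-1)) \leq 2 n\, \mathrm{wt}(p).$$
   Context: $\mathbb{Z}_N$ is the ring of integers modulo $N$, $\mathbb{Z}_N^\times$ its group of units, and $\mathrm{ord}$ is multiplicative order. Let $N\ge 3$ and let $k\in\mathbb{Z}_N^\times$ have multiplicative order $\alpha\ge 2$. For a sequence of integers $\underline{i}=(i_1,\dots,i_r)$ ($r\ge 1$) with $\alpha-1\ge i_1>i_2>\dots>i_r\ge 0$ and a sequence of integers $\underline{\lambda}=(\lambda_1,\dots,\lambda_r)$ with all $\lambda_j\ge 0$, put $$\Omega(\underline{i},\underline{\lambda})=\{\,b_1k^{i_1}+\dots+b_rk^{i_r} \pmod N : b_j\in\mathbb{Z},\ |b_j|\le\lambda_j,\ 1\le j\le r\,\}\subseteq\mathbb{Z}_N .$$ Define $$\mathrm{wt}(N,k;\underline{i})=\min\{\lambda_1+\dots+\lambda_r : \Omega(\underline{i},\underline{\lambda})=\mathbb{Z}_N\},$$ and, for $1\le r\le\alpha$, let $\mathrm{wt}(N,k;r)$ be the minimum of $\mathrm{wt}(N,k;\underline{i})$ over all such sequences $\underline{i}$ of length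 $r$. In particular $\mathrm{wt}(N,k;\alpha)=\mathrm{wt}(N,k;\Delta)$ with $\Delta=(\alpha-1,\alpha-2,\dots,1,0)$. The value $\mathrm{wt}(p,s;p-1)$ does not depend on the choice of the element $s\in\mathbb{Z}_p^\times$ of order $p-1$. *)

theory Defs
  imports "HOL-Number_Theory.Number_Theory"
begin

text \<open>
  The ring of integers modulo \<open>N\<close> is \<^term>\<open>residue_ring (int N)\<close>, with carrier
  \<open>{0..int N - 1}\<close>. An element \<open>k\<close> of it is given by any natural number in the residue class.
\<close>

definition exponent_seqs :: "nat \<Rightarrow> nat \<Rightarrow> nat list set" where
  "exponent_seqs \<alpha> r = {is. length is = r \<and> sorted_wrt (>) is \<and> set is \<subseteq> {..<\<alpha>}}"

definition Omega :: "nat \<Rightarrow> nat \<Rightarrow> nat list \<Rightarrow> nat list \<Rightarrow> int set" where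
  "Omega N k is ls =
     {(\<Sum>j<length is. b j * int k ^ (is ! j)) mod int N | b :: nat \<Rightarrow> int.
        \<forall>j<length is. \<bar>b j\<bar> \<le> int (ls ! j)}"

definition wt_seq :: "nat \<Rightarrow> nat \<Rightarrow> nat list \<Rightarrow> nat" where
  "wt_seq N k is =
     Inf {sum_list ls | ls. length ls = length is \<and> Omega N k is ls = carrier (residue_ring (int N))}"

definition wt :: "nat \<Rightarrow> nat \<Rightarrow> nat \<Rightarrow> nat" where
  "wt N k r = Inf (wt_seq N k ` exponent_seqs (ord N k) r)"

text \<open>
  The infima range over nonempty sets of natural numbers whenever \<open>k\<close> is a unit modulo \<open>N\<close> and
  \<open>1 \<le> r \<le> ord N k\<close>, so they are minima (and not the default value of \<^term>\<open>Inf {} :: nat\<close>).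
\<close>

lemma Omega_surjective:
  assumes "N > 0" "coprime k N" "is \<noteq> []"
  shows "Omega N k is (replicate (length is) N) = carrier (residue_ring (int N))"
proof
  show "Omega N k is (replicate (length is) N) \<subseteq> carrier (residue_ring (int N))"
    using assms(1) by (auto simp: Omega_def residue_ring_def)
  show "carrier (residue_ring (int N)) \<subseteq> Omega N k is (replicate (length is) N)"
  proof
    fix x assume "x \<in> carrier (residue_ring (int N))"
    hence x: "0 \<le> x" "x < int N" by (auto simp: residue_ring_def)
    have "coprime (int k ^ (is ! 0)) (int N)" using assms(2) by simp
    then obtain u where u: "[int k ^ (is ! 0) * u = 1] (mod int N)"
      using cong_solve_coprime_int by blast
    define c where "c = (x * u) mod int N"
    have c: "0 \<le> c" "c < int N" using assms(1) by (auto simp: c_def)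
    have "[c * int k ^ (is ! 0) = x * (int k ^ (is ! 0) * u)] (mod int N)"
      by (simp add: c_def cong_def mod_simps ac_simps)
    also have "[x * (int k ^ (is ! 0) * u) = x * 1] (mod int N)"
      by (rule cong_scalar_left[OF u])
    finally have cx: "(c * int k ^ (is ! 0)) mod int N = x" using x by (simp add: cong_def)
    define b where "b j = (if j = 0 then c else 0)" for j :: nat
    have "(\<Sum>j<length is. b j * int k ^ (is ! j)) = (\<Sum>j\<in>{0}. b j * int k ^ (is ! j))"
      using assms(3) by (intro sum.mono_neutral_right) (auto simp: b_def)
    hence "x = (\<Sum>j<length is. b j * int k ^ (is ! j)) mod int N"
      using cx by (simp add: b_def)
    moreover have "\<forall>j<length is. \<bar>b j\<bar> \<le> int (replicate (length is) N ! j)"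
      using c by (auto simp: b_def)
    ultimately show "x \<in> Omega N k is (replicate (length is) N)"
      unfolding Omega_def by blast
  qed
qed

lemma wt_seq_attained:
  assumes "N > 0" "coprime k N" "is \<noteq> []"
  obtains ls where "length ls = length is" "Omega N k is ls = carrier (residue_ring (int N))"
    "sum_list ls = wt_seq N k is"
proof -
  let ?S = "{sum_list ls | ls. length ls = length is \<and>
    Omega N k is ls = carrier (residue_ring (int N))}"
  have "sum_list (replicate (length is) N) \<in> ?S"
    by (intro CollectI exI[of _ "replicate (length is) N"] conjI refl length_replicate
        Omega_surjective[OF assms])
  hence "?S \<noteq> {}"
    by (metis empty_iff)
  hence "Inf ?S \<in> ?S"
    by (rule Inf_nat_def1)
  hence "wt_seq N k is \<in> ?S"
    by (simp only: wt_seq_def)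
  then obtain ls where "wt_seq N k is = sum_list ls" "length ls = length is"
      "Omega N k is ls = carrier (residue_ring (int N))"
    unfolding mem_Collect_eq by (elim exE conjE)
  thus ?thesis by (intro that) simp_all
qed

lemma exponent_seqs_full: "exponent_seqs \<alpha> \<alpha> = {rev [0..<\<alpha>]}"
proof -
  have "is = rev [0..<\<alpha>]" if "is \<in> exponent_seqs \<alpha> \<alpha>" for "is"
  proof -
    have s: "length is = \<alpha>" "sorted_wrt (<) (rev is)" "set is \<subseteq> {..<\<alpha>}"
      using that by (auto simp: exponent_seqs_def sorted_wrt_rev)
    have d: "sorted (rev is)" "distinct (rev is)"
      using s(2) strict_sorted_iff by blast+
    have "set is = {..<\<alpha>}"
      using s d by (intro card_subset_eq) (auto simp: distinct_card)
    hence "set (rev is) = set [0..<\<alpha>]"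
      by (simp add: atLeast0LessThan)
    hence "rev is = [0..<\<alpha>]"
      by (rule sorted_distinct_set_unique[OF d sorted_upt distinct_upt])
    thus ?thesis by (metis rev_rev_ident)
  qed
  moreover have "rev [0..<\<alpha>] \<in> exponent_seqs \<alpha> \<alpha>"
    by (auto simp: exponent_seqs_def sorted_wrt_rev)
  ultimately show ?thesis by blast
qed

lemma exponent_seqs_nonempty:
  assumes "r \<le> \<alpha>"
  shows "exponent_seqs \<alpha> r \<noteq> {}"
proof -
  have "rev [0..<r] \<in> exponent_seqs \<alpha> r"
    using assms by (auto simp: exponent_seqs_def sorted_wrt_rev)
  thus ?thesis by blast
qed

lemma wt_attained:
  assumes "r \<le> ord N k"
  obtains "is" where "is \<in> exponent_seqs (ord N k) r" "wt_seq N k is = wt N k r"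
proof -
  have "wt N k r \<in> wt_seq N k ` exponent_seqs (ord N k) r"
    unfolding wt_def by (intro Inf_nat_def1) (simp add: exponent_seqs_nonempty[OF assms])
  thus ?thesis using that by (metis imageE)
qed

lemma wt_full: "wt N k (ord N k) = wt_seq N k (rev [0..<ord N k])"
  by (simp add: wt_def exponent_seqs_full)

end

theory Submission
  imports Defs
begin

text \<open>
  With all exponents \<open>0, \<dots>, ord N k - 1\<close> available, \<^term>\<open>wt N k (ord N k)\<close> is the least total
  weight of \<^emph>\<open>any\<close> finite family of powers of \<open>k\<close> whose weighted integer combinations exhaust the
  residues mod \<open>N\<close>: powers with exponents in the same class mod \<^term>\<open>ord N k\<close> coincide, so
  their coefficients and their weights can be added up (\<open>wt_le_of_covers\<close>). Both inequalities then
  only need a covering family of the right total weight.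

  Lower bound: a family covering the residues mod \<open>p ^ n\<close> also covers those mod \<open>p\<close>,
  and all exponents may be used mod \<open>p\<close> as well, because a primitive root mod \<open>p ^ n\<close> stays one
  mod \<open>p\<close> (\<open>ord_prime_of_residue_primroot_power\<close>).

  Upper bound: let the powers \<open>k ^ j\<close> with weights \<open>w j\<close> cover the residues mod \<open>p\<close>. Expanding an
  integer to base \<open>p\<close>, with these combinations as digits, shows that it is congruent to a
  combination of the \<open>p ^ i * k ^ j\<close>, \<open>i < n\<close>, modulo \<open>p ^ n\<close>. Since \<open>p\<close> is odd, \<open>1 + p ^ i\<close> is a
  unit even for \<open>i = 0\<close>, hence it is a power \<open>k ^ a\<close> of the generator \<open>k\<close>, and
  \<open>p ^ i * k ^ j = (1 + p ^ i) * k ^ j - k ^ j = k ^ (a + j) - k ^ j\<close> modulo \<open>p ^ n\<close>. So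
  each of the \<open>n\<close> digits costs twice the weight of the covering mod \<open>p\<close>
  (\<open>covers_power_modulus\<close>, \<open>covers_diff\<close>).
\<close>

section \<open>Families with bounded coefficients that exhaust the residues\<close>

text \<open>
  The generators form an indexed family rather than a set: in the families below the same residue
  may occur under several indices, each time with a coefficient of its own.
\<close>

definition covers :: "int \<Rightarrow> 'i set \<Rightarrow> ('i \<Rightarrow> int) \<Rightarrow> ('i \<Rightarrow> nat) \<Rightarrow> bool" where
  "covers m I g w \<longleftrightarrow>
     (\<forall>x. \<exists>b. (\<forall>i\<in>I. \<bar>b i\<bar> \<le> int (w i)) \<and> [x = (\<Sum>i\<in>I. b i * g i)] (mod m))"

lemma coversE:
  assumes "covers m I g w"
  obtains b where "\<And>i. i \<in> I \<Longrightarrow> \<bar>b i\<bar> \<le> int (w i)" "[x = (\<Sum>i\<in>I. b i * g i)] (mod m)"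
  using assms unfolding covers_def by blast

lemma covers_cong:
  assumes "covers m I g w" and "\<And>i. i \<in> I \<Longrightarrow> [g i = h i] (mod m)"
  shows "covers m I h w"
  unfolding covers_def
proof
  fix x
  from assms(1) obtain b where b: "\<And>i. i \<in> I \<Longrightarrow> \<bar>b i\<bar> \<le> int (w i)"
    "[x = (\<Sum>i\<in>I. b i * g i)] (mod m)" by (rule coversE) blast
  have "[(\<Sum>i\<in>I. b i * g i) = (\<Sum>i\<in>I. b i * h i)] (mod m)"
    by (intro cong_sum cong_scalar_left assms(2))
  with b show "\<exists>b. (\<forall>i\<in>I. \<bar>b i\<bar> \<le> int (w i)) \<and> [x = (\<Sum>i\<in>I. b i * h i)] (mod m)"
    using cong_trans by blast
qed

lemma covers_dvd_modulus:
  assumes "covers m I g w" and "d dvd m"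
  shows "covers d I g w"
  using assms(1) cong_dvd_modulus[OF _ assms(2)] unfolding covers_def by blast

section \<open>The weight as an optimum over families of powers\<close>

lemma cong_power_mod_ord:
  assumes "[k ^ d = 1] (mod m)"
  shows "[k ^ e = k ^ (e mod d)] (mod (m :: int))"
proof -
  have "k ^ e = (k ^ d) ^ (e div d) * k ^ (e mod d)"
    by (simp flip: power_mult power_add)
  also have "[\<dots> = 1 ^ (e div d) * k ^ (e mod d)] (mod m)"
    by (intro cong_mult cong_pow assms cong_refl)
  finally show ?thesis by simp
qed

lemma sum_fibres_mod:
  fixes f :: "'i \<Rightarrow> 'a :: comm_monoid_add"
  assumes "finite I" and "\<alpha> > (0 :: nat)"
  shows "(\<Sum>j<\<alpha>. \<Sum>i | i \<in> I \<and> e i mod \<alpha> = j. f i) = (\<Sum>i\<in>I. f i)"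
  by (rule sum.group) (use assms in auto)

text \<open>
  Terms whose exponents agree modulo the order of \<open>k\<close> are merged; the triangle inequality bounds
  the merged coefficient by the merged weight.
\<close>

lemma wt_le_of_covers:
  assumes "N > 0" and "coprime k N" and "finite I"
    and cov: "covers (int N) I (\<lambda>i. int k ^ e i) w"
  shows "wt N k (ord N k) \<le> (\<Sum>i\<in>I. w i)"
proof -
  define \<alpha> where "\<alpha> = ord N k"
  have \<alpha>: "\<alpha> > 0" using assms(2) by (simp add: \<alpha>_def coprime_commute)
  have "[int k ^ \<alpha> = 1] (mod int N)"
    using ord[of k N] unfolding \<alpha>_def by (metis cong_int_iff of_nat_1 of_nat_power)
  note pow = cong_power_mod_ord[OF this]
  define W where "W j = (\<Sum>i | i \<in> I \<and> e i mod \<alpha> = j. w i)" for j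
  let ?is = "rev [0..<\<alpha>]"
  let ?ls = "map W ?is"
  have nth: "?is ! j = \<alpha> - Suc j" if "j < \<alpha>" for j
    using that by (simp add: rev_nth)
  \<comment> \<open>exponents are listed in decreasing order, so sums over positions are reindexed by reversal\<close>
  have "sum_list ?ls = (\<Sum>j<\<alpha>. W j)"
    by (simp add: rev_map[symmetric] sum_list_rev interv_sum_list_conv_sum_set_nat atLeast0LessThan)
  also have "\<dots> = (\<Sum>i\<in>I. w i)"
    unfolding W_def by (rule sum_fibres_mod) (use \<alpha> assms(3) in auto)
  finally have sum_ls: "sum_list ?ls = (\<Sum>i\<in>I. w i)" .
  have "Omega N k ?is ?ls = carrier (residue_ring (int N))"
  proof
    show "Omega N k ?is ?ls \<subseteq> carrier (residue_ring (int N))"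
      using assms(1) by (auto simp: Omega_def residue_ring_def)
    show "carrier (residue_ring (int N)) \<subseteq> Omega N k ?is ?ls"
    proof
      fix x assume "x \<in> carrier (residue_ring (int N))"
      hence x: "0 \<le> x" "x < int N" by (auto simp: residue_ring_def)
      from cov obtain b where b: "\<And>i. i \<in> I \<Longrightarrow> \<bar>b i\<bar> \<le> int (w i)"
        "[x = (\<Sum>i\<in>I. b i * int k ^ e i)] (mod int N)" by (rule coversE) blast
      define B where "B j = (\<Sum>i | i \<in> I \<and> e i mod \<alpha> = j. b i)" for j
      have B: "\<bar>B j\<bar> \<le> int (W j)" for j
        unfolding B_def W_def of_nat_sum using b(1) by (intro sum_abs[THEN order_trans] sum_mono) auto
      have "(\<Sum>j<\<alpha>. B (?is ! j) * int k ^ (?is ! j)) = (\<Sum>j<\<alpha>. B j * int k ^ j)"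
        by (subst sum.nat_diff_reindex[symmetric]) (simp add: nth)
      also have "\<dots> = (\<Sum>j<\<alpha>. \<Sum>i | i \<in> I \<and> e i mod \<alpha> = j. b i * int k ^ (e i mod \<alpha>))"
        unfolding B_def sum_distrib_right by (intro sum.cong) auto
      also have "\<dots> = (\<Sum>i\<in>I. b i * int k ^ (e i mod \<alpha>))"
        by (rule sum_fibres_mod) (use \<alpha> assms(3) in auto)
      also have "[\<dots> = (\<Sum>i\<in>I. b i * int k ^ e i)] (mod int N)"
        by (intro cong_sum cong_scalar_left cong_sym[OF pow])
      also have "[(\<Sum>i\<in>I. b i * int k ^ e i) = x] (mod int N)"
        by (rule cong_sym) (rule b(2))
      finally have "x = (\<Sum>j<length ?is. B (?is ! j) * int k ^ (?is ! j)) mod int N"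
        using x by (simp add: cong_def)
      moreover have "\<forall>j<length ?is. \<bar>B (?is ! j)\<bar> \<le> int (?ls ! j)"
        using B by simp
      ultimately show "x \<in> Omega N k ?is ?ls"
        unfolding Omega_def mem_Collect_eq
        by (intro exI[of _ "\<lambda>j. B (?is ! j)"] conjI)
    qed
  qed
  hence "wt_seq N k ?is \<le> sum_list ?ls"
    unfolding wt_seq_def by (intro cInf_lower CollectI exI[of _ ?ls] conjI refl) simp_all
  thus ?thesis using sum_ls by (simp add: wt_full \<alpha>_def)
qed

text \<open>
  Conversely the weight is attained by a covering family, which lets both inequalities start from
  an optimal one.
\<close>

lemma wt_covers:
  assumes "N > 0" and "coprime k N"
  obtains w where "(\<Sum>j<ord N k. w j) = wt N k (ord N k)"
    and "covers (int N) {..<ord N k} (\<lambda>j. int k ^ j) w"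
proof -
  define \<alpha> where "\<alpha> = ord N k"
  have \<alpha>: "\<alpha> > 0" using assms(2) by (simp add: \<alpha>_def coprime_commute)
  let ?is = "rev [0..<\<alpha>]"
  have "?is \<noteq> []" using \<alpha> by simp
  then obtain ls where ls: "length ls = length ?is"
      "Omega N k ?is ls = carrier (residue_ring (int N))" "sum_list ls = wt_seq N k ?is"
    using wt_seq_attained[OF assms] by blast
  define w where "w j = ls ! (\<alpha> - Suc j)" for j
  have "(\<Sum>j<\<alpha>. w j) = (\<Sum>j<\<alpha>. ls ! j)"
    unfolding w_def by (rule sum.nat_diff_reindex)
  also have "\<dots> = wt N k \<alpha>"
    using ls by (simp add: sum_list_sum_nth atLeast0LessThan wt_full \<alpha>_def)
  finally have 1: "(\<Sum>j<\<alpha>. w j) = wt N k \<alpha>" .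
  have 2: "covers (int N) {..<\<alpha>} (\<lambda>j. int k ^ j) w"
    unfolding covers_def
  proof
    fix x
    have "x mod int N \<in> Omega N k ?is ls"
      using assms(1) by (simp add: ls(2) residue_ring_def pos_mod_bound zle_diff1_eq)
    then obtain b where b: "x mod int N = (\<Sum>j<\<alpha>. b j * int k ^ (?is ! j)) mod int N"
        "\<And>j. j < \<alpha> \<Longrightarrow> \<bar>b j\<bar> \<le> int (ls ! j)"
      unfolding Omega_def by auto
    define c where "c j = b (\<alpha> - Suc j)" for j
    have "(\<Sum>j<\<alpha>. b j * int k ^ (?is ! j)) = (\<Sum>j<\<alpha>. c j * int k ^ j)"
      by (subst sum.nat_diff_reindex[symmetric]) (simp add: c_def rev_nth)
    hence "[x = (\<Sum>j<\<alpha>. c j * int k ^ j)] (mod int N)"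
      using b(1) by (simp add: cong_def)
    moreover have "\<forall>j\<in>{..<\<alpha>}. \<bar>c j\<bar> \<le> int (w j)"
      using b(2) by (simp add: c_def w_def)
    ultimately show "\<exists>b. (\<forall>j\<in>{..<\<alpha>}. \<bar>b j\<bar> \<le> int (w j)) \<and>
        [x = (\<Sum>j<\<alpha>. b j * int k ^ j)] (mod int N)" by blast
  qed
  from 1 2 show ?thesis unfolding \<alpha>_def by (rule that)
qed

section \<open>Lifting a covering family to a power of the modulus\<close>

text \<open>
  Expansion to base \<open>m\<close> whose digits are the combinations of the \<open>g j\<close>: they meet every residue
  class mod \<open>m\<close>, and that is all the successive division by \<open>m\<close> asks of a digit set.
\<close>

lemma covers_power_modulus:
  assumes cov: "covers m J g w"
  shows "covers (m ^ n) ({..<n} \<times> J) (\<lambda>z. m ^ fst z * g (snd z)) (\<lambda>z. w (snd z))"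
proof -
  have digits: "\<exists>b. (\<forall>i. \<forall>j\<in>J. \<bar>b i j\<bar> \<le> int (w j)) \<and>
      [x = (\<Sum>i<n. \<Sum>j\<in>J. b i j * (m ^ i * g j))] (mod m ^ n)" for x
  proof (induction n)
    case 0
    show ?case by (intro exI[of _ "\<lambda>_ _. 0"]) simp
  next
    case (Suc n)
    then obtain b where b: "\<And>i j. j \<in> J \<Longrightarrow> \<bar>b i j\<bar> \<le> int (w j)"
      "[x = (\<Sum>i<n. \<Sum>j\<in>J. b i j * (m ^ i * g j))] (mod m ^ n)" by blast
    define s where "s = (\<Sum>i<n. \<Sum>j\<in>J. b i j * (m ^ i * g j))"
    from b(2) obtain y where y: "x - s = m ^ n * y"
      unfolding s_def cong_iff_dvd_diff by (rule dvdE)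
    from cov obtain c where c: "\<And>j. j \<in> J \<Longrightarrow> \<bar>c j\<bar> \<le> int (w j)"
      "[y = (\<Sum>j\<in>J. c j * g j)] (mod m)" by (rule coversE) blast
    define b' where "b' = b(n := c)"
    have "[m ^ n * y = m ^ n * (\<Sum>j\<in>J. c j * g j)] (mod m ^ Suc n)"
      using c(2)
      by (auto simp: cong_iff_dvd_diff mult.commute[of m] simp flip: right_diff_distrib
          intro!: mult_dvd_mono)
    hence "[s + m ^ n * y = s + m ^ n * (\<Sum>j\<in>J. c j * g j)] (mod m ^ Suc n)"
      by (rule cong_add[OF cong_refl])
    moreover have "x = s + m ^ n * y" using y by simp
    moreover have "s + m ^ n * (\<Sum>j\<in>J. c j * g j) = (\<Sum>i<Suc n. \<Sum>j\<in>J. b' i j * (m ^ i * g j))"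
      by (simp add: s_def b'_def sum_distrib_left mult_ac)
    ultimately have "[x = (\<Sum>i<Suc n. \<Sum>j\<in>J. b' i j * (m ^ i * g j))] (mod m ^ Suc n)" by simp
    moreover have "\<forall>i. \<forall>j\<in>J. \<bar>b' i j\<bar> \<le> int (w j)" using b(1) c(1) by (simp add: b'_def)
    ultimately show ?case by blast
  qed
  have "\<exists>b. (\<forall>z\<in>{..<n} \<times> J. \<bar>b z\<bar> \<le> int (w (snd z))) \<and>
      [x = (\<Sum>z\<in>{..<n} \<times> J. b z * (m ^ fst z * g (snd z)))] (mod m ^ n)" for x
  proof -
    from digits[of x] obtain b where b: "\<forall>i. \<forall>j\<in>J. \<bar>b i j\<bar> \<le> int (w j)"
      "[x = (\<Sum>i<n. \<Sum>j\<in>J. b i j * (m ^ i * g j))] (mod m ^ n)" by blast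
    thus ?thesis
      by (intro exI[of _ "\<lambda>z. b (fst z) (snd z)"])
         (auto simp: sum.cartesian_product case_prod_beta)
  qed
  thus ?thesis by (simp add: covers_def case_prod_beta)
qed

text \<open>
  A coefficient of \<open>g i - h i\<close> is used twice, with opposite signs, once the two terms become
  separate generators; this is where the factor 2 of the upper bound comes from.
\<close>

lemma covers_diff:
  assumes "covers m I (\<lambda>i. g i - h i) w" and "finite I"
  shows "covers m (I \<times> UNIV) (\<lambda>z. if snd z then g (fst z) else h (fst z)) (\<lambda>z. w (fst z))"
  unfolding covers_def
proof
  fix x
  from assms(1) obtain b where b: "\<And>i. i \<in> I \<Longrightarrow> \<bar>b i\<bar> \<le> int (w i)"
    "[x = (\<Sum>i\<in>I. b i * (g i - h i))] (mod m)" by (rule coversE) blast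
  define b' where "b' z = (if snd z then b (fst z) else - b (fst z))" for z
  have "(\<Sum>z\<in>I \<times> UNIV. b' z * (if snd z then g (fst z) else h (fst z))) =
      (\<Sum>i\<in>I. \<Sum>c\<in>UNIV. b' (i, c) * (if c then g i else h i))"
    unfolding sum.cartesian_product' fst_conv snd_conv ..
  also have "\<dots> = (\<Sum>i\<in>I. b i * (g i - h i))"
    by (simp add: UNIV_bool b'_def algebra_simps)
  finally have "[x = (\<Sum>z\<in>I \<times> UNIV. b' z * (if snd z then g (fst z) else h (fst z)))] (mod m)"
    using b(2) by simp
  moreover have "\<forall>z\<in>I \<times> UNIV. \<bar>b' z\<bar> \<le> int (w (fst z))"
    using b(1) by (auto simp: b'_def)
  ultimately show "\<exists>b. (\<forall>z\<in>I \<times> UNIV. \<bar>b z\<bar> \<le> int (w (fst z))) \<and>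
      [x = (\<Sum>z\<in>I \<times> UNIV. b z * (if snd z then g (fst z) else h (fst z)))] (mod m)"
    by blast
qed

section \<open>Primitive roots modulo a prime power\<close>

lemma residue_primroot_generates:
  assumes "residue_primroot m g" and "m > 1" and "coprime x m"
  obtains i where "[g ^ i = x] (mod m)"
proof -
  have "x mod m \<in> totatives m"
    using assms(2,3) by (auto simp: totatives_def intro!: Nat.gr0I)
  also have "totatives m = (\<lambda>i. g ^ i mod m) ` {..<totient m}"
    using residue_primroot_is_generator[OF assms(2,1)] by (simp add: bij_betw_def)
  finally obtain i where "g ^ i mod m = x mod m" by auto
  thus ?thesis by (intro that) (simp add: cong_def)
qed

text \<open>
  Some primitive root \<open>h\<close> mod \<open>p\<close> exists; being prime to \<open>p ^ n\<close> it is a power of \<open>g\<close>, so its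
  order \<open>p - 1\<close> divides that of \<open>g\<close>.
\<close>

lemma ord_prime_of_residue_primroot_power:
  assumes "prime p" and "n > 0" and "residue_primroot (p ^ n) g"
  shows "ord p g = p - 1"
proof (rule dvd_antisym)
  have p: "p > 1" using assms(1) by (rule prime_gt_1_nat)
  have cop: "coprime p g"
    using assms(2,3) by (simp add: residue_primroot_def)
  show "ord p g dvd p - 1"
    using order_divides_totient[OF cop] assms(1) by (simp add: totient_prime)
  obtain h where h: "residue_primroot p h"
    using prime_primitive_root_exists[of p] assms(1) p by blast
  have "coprime h (p ^ n)"
    using h by (simp add: residue_primroot_def coprime_commute)
  moreover have "p ^ n > 1" using p assms(2) by (intro one_less_power)
  ultimately obtain i where "[g ^ i = h] (mod p ^ n)"
    using residue_primroot_generates assms(3) by blast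
  hence i: "[g ^ i = h] (mod p)"
    by (rule cong_dvd_modulus_nat) (use assms(2) in simp)
  have "[(g ^ i) ^ ord p g = (g ^ ord p g) ^ i] (mod p)"
    by (simp add: mult.commute flip: power_mult)
  also have "[(g ^ ord p g) ^ i = 1 ^ i] (mod p)"
    by (intro cong_pow ord)
  finally have "[h ^ ord p g = 1] (mod p)"
    using cong_trans[OF cong_pow[OF cong_sym[OF i]]] by simp
  hence "ord p h dvd ord p g" by (simp only: ord_divides)
  thus "p - 1 dvd ord p g"
    using h assms(1) by (simp add: residue_primroot_def totient_prime)
qed

section \<open>Comparison of the weights modulo a prime and its powers\<close>

theorem theorem2:
  fixes p n k :: nat
  assumes "prime p" "odd p"
    and "n \<ge> 1"
    and "coprime k (p ^ n)"
    and "ord (p ^ n) k = p ^ (n - 1) * (p - 1)"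
  shows "wt p (k mod p) (p - 1) \<le> wt (p ^ n) k (p ^ (n - 1) * (p - 1))
       \<and> wt (p ^ n) k (p ^ (n - 1) * (p - 1)) \<le> 2 * n * wt p (k mod p) (p - 1)"
proof
  define s where "s = k mod p"
  define N where "N = p ^ n"
  have p: "p > 1" using assms(1) by (rule prime_gt_1_nat)
  have N: "N > 1" "p dvd N" using one_less_power[OF p, of n] assms(3) by (simp_all add: N_def)
  have p0: "p > 0" and N0: "N > 0" using p N by auto
  have root: "residue_primroot N k"
    using assms N p by (simp add: N_def residue_primroot_def totient_prime_power coprime_commute)
  have copN: "coprime k N" using assms(4) by (simp add: N_def)
  have cop: "coprime s p" using assms(3,4) p by (simp add: s_def)
  have ordN: "ord N k = p ^ (n - 1) * (p - 1)" using assms(5) by (simp add: N_def)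
  have ords: "ord p s = p - 1"
    using ord_prime_of_residue_primroot_power[of p n k] root assms(1,3)
    by (simp add: N_def s_def)
  have ks: "[int k ^ j = int s ^ j] (mod int p)" for j
    by (intro cong_pow) (simp add: s_def zmod_int cong_def)

  obtain v where v: "(\<Sum>j<ord N k. v j) = wt N k (ord N k)"
      "covers (int N) {..<ord N k} (\<lambda>j. int k ^ j) v"
    using N0 copN by (rule wt_covers)
  have "covers (int p) {..<ord N k} (\<lambda>j. int k ^ j) v"
    using v(2) by (rule covers_dvd_modulus) (use N in simp)
  hence "covers (int p) {..<ord N k} (\<lambda>j. int s ^ j) v"
    by (rule covers_cong) (rule ks)
  hence "wt p s (ord p s) \<le> (\<Sum>j<ord N k. v j)"
    using p cop by (intro wt_le_of_covers) auto
  thus "wt p (k mod p) (p - 1) \<le> wt (p ^ n) k (p ^ (n - 1) * (p - 1))"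
    unfolding v(1) unfolding ords ordN unfolding s_def N_def .

  have "\<exists>a. [k ^ a = 1 + p ^ i] (mod N)" for i
  proof -
    have "coprime (1 + p ^ i) p"
    proof (cases "i = 0")
      case True
      \<comment> \<open>here \<open>1 + p ^ i = 2\<close>, a unit because \<open>p\<close> is odd\<close>
      thus ?thesis using assms(2) by (simp only: power_0 one_add_one coprime_left_2_iff_odd simp_thms)
    next
      case False
      hence "[1 + p ^ i = 1 + 0] (mod p)"
        by (intro cong_add cong_refl) (simp add: cong_0_iff)
      thus ?thesis by (rule cong_imp_coprime[OF cong_sym]) simp
    qed
    hence "coprime (1 + p ^ i) N" by (simp add: N_def)
    then obtain a where "[k ^ a = 1 + p ^ i] (mod N)"
      by (rule residue_primroot_generates[OF root N(1)])
    thus ?thesis by blast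
  qed
  then obtain a where a: "\<And>i. [k ^ a i = 1 + p ^ i] (mod N)" by metis
  have diff: "[int p ^ i * int k ^ j = int k ^ (a i + j) - int k ^ j] (mod int N)" for i j
  proof -
    have "[int k ^ a i = 1 + int p ^ i] (mod int N)"
      using a[of i] by (simp flip: cong_int_iff)
    hence "[int k ^ a i * int k ^ j - int k ^ j = (1 + int p ^ i) * int k ^ j - int k ^ j] (mod int N)"
      by (intro cong_diff cong_mult cong_refl)
    moreover have "(1 + int p ^ i) * int k ^ j - int k ^ j = int p ^ i * int k ^ j"
      by (simp add: algebra_simps)
    ultimately show ?thesis by (simp only: power_add cong_sym)
  qed

  obtain w where w: "(\<Sum>j<p - 1. w j) = wt p s (p - 1)"
      "covers (int p) {..<p - 1} (\<lambda>j. int s ^ j) w"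
    using p0 cop by (rule wt_covers[of p s, unfolded ords])
  \<comment> \<open>an index \<open>(i, j)\<close> stands for \<open>p ^ i * k ^ j\<close>; a further truth value selects one of the two
    powers of \<open>k\<close> whose difference it is\<close>
  let ?I = "{..<n} \<times> {..<p - 1}"
  have "covers (int p) {..<p - 1} (\<lambda>j. int k ^ j) w"
    using w(2) by (rule covers_cong) (rule cong_sym[OF ks])
  hence "covers (int N) ?I (\<lambda>z. int p ^ fst z * int k ^ snd z) (\<lambda>z. w (snd z))"
    unfolding N_def of_nat_power by (rule covers_power_modulus)
  hence "covers (int N) ?I (\<lambda>z. int k ^ (a (fst z) + snd z) - int k ^ snd z)
      (\<lambda>z. w (snd z))"
    by (rule covers_cong) (rule diff)
  hence "covers (int N) (?I \<times> UNIV)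
      (\<lambda>u. if snd u then int k ^ (a (fst (fst u)) + snd (fst u)) else int k ^ snd (fst u))
      (\<lambda>u. w (snd (fst u)))"
    by (rule covers_diff) simp
  hence "covers (int N) (?I \<times> UNIV)
      (\<lambda>u. int k ^ (if snd u then a (fst (fst u)) + snd (fst u) else snd (fst u)))
      (\<lambda>u. w (snd (fst u)))"
    by (rule covers_cong) simp
  hence "wt N k (ord N k) \<le> (\<Sum>u\<in>?I \<times> (UNIV :: bool set). w (snd (fst u)))"
    by (intro wt_le_of_covers[OF N0 copN]) simp_all
  also have "\<dots> = 2 * n * (\<Sum>j<p - 1. w j)"
    by (simp add: sum.cartesian_product' sum_distrib_left mult_ac)
  finally show "wt (p ^ n) k (p ^ (n - 1) * (p - 1)) \<le> 2 * n * wt p (k mod p) (p - 1)"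
    unfolding w(1) ordN unfolding s_def N_def .
qed

end
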